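(* Consider one step, from $(u_\gamma^n,r_\gamma^n)$ to $(u_\gamma^{n+1},r_\gamma^{n+1})$ with stepsize $\tau>0$, of the $s$-stage diagonally implicit-explicit relaxation Runge-Kutta (IMEX RRK) method with relaxation coefficient $\gamma_n$, as defined in the context, applied to the scalar-auxiliary-variable form of the Allen-Cahn or Cahn-Hilliard gradient flow. If $\gamma_n>0$ and $b_j=\bar b_j\ge 0$ for $j=1,\dots,s$, then the method preserves the discrete (modified) energy decay property $$E[u_\gamma^{n+1},r_\gamma^{n+1}]\le E[u_\gamma^{n},r_\gamma^{n}],\qquad\text{where } E[u,r]=\frac{\epsilon^2}{2}\|\nabla u\|^2+r^2-C_0 .$$
   Context: Setting. $\Omega$ is a bounded rectangular domain with periodic boundary conditions; $\langle\cdot,\cdot\rangle$ and $\|\cdot\|$ are the $L^2(\Omega)$ inner product and norm; $\epsilon>0$; $F:\mathbb R\to\mathbb R$ is a smooth potential; $\mathcal G$ is the non-positive operator $\mathcal G=-\mathcal I$ (Allen-Cahn) or $\mathcal G=\Delta$ (Cahn-Hilliard); $C_0\ge 0$ is a constant such that $\int_\Omega F(u)\,\mathrm d x+C_0>0$ for all functions $u$ where this expression occurs. All functions are periodic and regular enough that all expressions are defined. The scalar auxiliary variable (SAV) system for $u=u(x,t)$ and a scalar $r=r(t)$ is $u_t=L(u)+N(u,r)$, $r_t=\tilde N(u,r)$, where $$L(u)=\mathcal G(-\epsilon^2\Delta u),\qquad N(u,r)=\mathcal G\Big(\tfrac{r}{\sqrt{\int_\Omega F(u)\,\mathrm d x+C_0}}F'(u)\Big),$$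 $$\tilde N(u,r)=\tfrac{1}{2\sqrt{\int_\Omega F(u)\,\mathrm d x+C_0}}\big\langle F'(u),\,L(u)+N(u,r)\big\rangle .$$ Coefficients. Real matrices $A=(a_{ij})_{s\times s}$ with $a_{ij}=0$ for $j>i$, $\bar A=(\bar a_{ij})_{s\times s}$ with $\bar a_{ij}=0$ for $j\ge i$, and real weights $b_i,\bar b_i$ with $\sum_i b_i=\sum_i\bar b_i=1$. IMEX RRK method. Given $(u_\gamma^n,r_\gamma^n)$ and $\tau>0$, the stages $U_{ni},R_{ni}$, $i=1,\dots,s$, satisfy $$U_{ni}=u_\gamma^n+\tau\sum_{j=1}^{i}a_{ij}L_{nj}+\tau\sum_{j=1}^{i-1}\bar a_{ij}N_{nj},\qquad R_{ni}=r_\gamma^n+\tau\sum_{j=1}^{i-1}\bar a_{ij}\tilde N_{nj},$$ with $L_{nj}=L(U_{nj})$, $N_{nj}=N(U_{nj},R_{nj})$, $\tilde N_{nj}=\tilde N(U_{nj},R_{nj})$, and the update is $$u_\gamma^{n+1}=u_\gamma^n+\gamma_n\tau\sum_{i=1}^s(b_iL_{ni}+\bar b_iN_{ni}),\qquad r_\gamma^{n+1}=r_\gamma^n+\gamma_n\tau\sum_{i=1}^s\bar b_i\tilde N_{ni}.$$ Relaxation coefficient. Let $$D_n=\frac{\epsilon^2}{2}\Big\|\nabla\Big(\sum_{i=1}^s b_iL_{ni}+\sum_{i=1}^s\bar b_iN_{ni}\Big)\Big\|^2+\Big(\sum_{i=1}^s\bar b_i\tilde N_{ni}\Big)^2 .$$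 If $D_n\neq0$, then $$\gamma_n=\frac{\sum_{i=1}^s\big[\epsilon^2\langle u_\gamma^n-U_{ni},\Delta(b_iL_{ni}+\bar b_iN_{ni})\rangle-2(r_\gamma^n-R_{ni})\bar b_i\tilde N_{ni}\big]}{\tau D_n};$$ if $D_n=0$, then $\gamma_n=1$. *)

theory Defs
  imports "HOL-Analysis.Analysis"
begin

definition pdiff :: "'a::euclidean_space \<Rightarrow> ('a \<Rightarrow> real) \<Rightarrow> 'a \<Rightarrow> real" where
  "pdiff i u x = frechet_derivative u (at x) i"

definition gradient :: "('a::euclidean_space \<Rightarrow> real) \<Rightarrow> 'a \<Rightarrow> 'a" where
  "gradient u x = (\<Sum>i\<in>Basis. pdiff i u x *\<^sub>R i)"

definition laplacian :: "('a::euclidean_space \<Rightarrow> real) \<Rightarrow> 'a \<Rightarrow> real" where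
  "laplacian u x = (\<Sum>i\<in>Basis. pdiff i (pdiff i u) x)"

lemma gderiv_gradient:
  assumes "u differentiable (at x)"
  shows "GDERIV u x :> gradient u x"
proof -
  have d: "(u has_derivative frechet_derivative u (at x)) (at x)"
    using assms frechet_derivative_works by blast
  then interpret linear "frechet_derivative u (at x)"
    by (rule has_derivative_linear)
  have "frechet_derivative u (at x) h = h \<bullet> gradient u x" for h
  proof -
    have "frechet_derivative u (at x) h
        = frechet_derivative u (at x) (\<Sum>i\<in>Basis. (h \<bullet> i) *\<^sub>R i)"
      by (simp add: euclidean_representation)
    also have "\<dots> = (\<Sum>i\<in>Basis. (h \<bullet> i) * frechet_derivative u (at x) i)"
      by (simp add: sum scaleR)
    also have "\<dots> = h \<bullet> gradient u x"
      by (simp add: gradient_def pdiff_def inner_sum_right mult.commute)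
    finally show ?thesis .
  qed
  then have "frechet_derivative u (at x) = (\<lambda>h. h \<bullet> gradient u x)"
    by blast
  with d show ?thesis
    by (simp add: gderiv_def)
qed

primrec C_k :: "nat \<Rightarrow> ('a::euclidean_space \<Rightarrow> real) \<Rightarrow> bool" where
  "C_k 0 u \<longleftrightarrow> continuous_on UNIV u"
| "C_k (Suc k) u \<longleftrightarrow> (\<forall>x. u differentiable (at x)) \<and> (\<forall>i\<in>Basis. C_k k (pdiff i u))"

definition smooth_real :: "(real \<Rightarrow> real) \<Rightarrow> bool" where
  "smooth_real F \<longleftrightarrow> (\<forall>k x. ((deriv ^^ k) F) differentiable (at x))"

text \<open>Periodic boundary conditions on the rectangle \<open>box lo hi\<close>: functions on the rectangle
  are identified with their periodic extensions to the whole space.\<close>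

definition periodic_box :: "'a::euclidean_space \<Rightarrow> 'a \<Rightarrow> ('a \<Rightarrow> real) \<Rightarrow> bool" where
  "periodic_box lo hi u \<longleftrightarrow> (\<forall>i\<in>Basis. \<forall>x. u (x + ((hi - lo) \<bullet> i) *\<^sub>R i) = u x)"

definition L2_inner :: "'a::euclidean_space set \<Rightarrow> ('a \<Rightarrow> 'b::real_inner) \<Rightarrow> ('a \<Rightarrow> 'b) \<Rightarrow> real" where
  "L2_inner \<Omega> f g = (LINT x:\<Omega>|lborel. f x \<bullet> g x)"

definition L2_norm :: "'a::euclidean_space set \<Rightarrow> ('a \<Rightarrow> 'b::real_inner) \<Rightarrow> real" where
  "L2_norm \<Omega> f = sqrt (L2_inner \<Omega> f f)"

definition allen_cahn_op :: "('a::euclidean_space \<Rightarrow> real) \<Rightarrow> 'a \<Rightarrow> real" where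
  "allen_cahn_op v = (\<lambda>x. - v x)"

definition cahn_hilliard_op :: "('a::euclidean_space \<Rightarrow> real) \<Rightarrow> 'a \<Rightarrow> real" where
  "cahn_hilliard_op v = laplacian v"

definition potential_int ::
    "'a::euclidean_space set \<Rightarrow> (real \<Rightarrow> real) \<Rightarrow> ('a \<Rightarrow> real) \<Rightarrow> real" where
  "potential_int \<Omega> F u = (LINT x:\<Omega>|lborel. F (u x))"

definition sav_L ::
    "(('a::euclidean_space \<Rightarrow> real) \<Rightarrow> 'a \<Rightarrow> real) \<Rightarrow> real \<Rightarrow> ('a \<Rightarrow> real) \<Rightarrow> 'a \<Rightarrow> real" where
  "sav_L G \<epsilon> u = G (\<lambda>x. - \<epsilon>\<^sup>2 * laplacian u x)"

definition sav_N ::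
    "'a::euclidean_space set \<Rightarrow> (('a \<Rightarrow> real) \<Rightarrow> 'a \<Rightarrow> real) \<Rightarrow> (real \<Rightarrow> real) \<Rightarrow> real
      \<Rightarrow> ('a \<Rightarrow> real) \<Rightarrow> real \<Rightarrow> 'a \<Rightarrow> real" where
  "sav_N \<Omega> G F C\<^sub>0 u r =
     G (\<lambda>x. r / sqrt (potential_int \<Omega> F u + C\<^sub>0) * deriv F (u x))"

definition sav_N_tilde ::
    "'a::euclidean_space set \<Rightarrow> (('a \<Rightarrow> real) \<Rightarrow> 'a \<Rightarrow> real) \<Rightarrow> real \<Rightarrow> (real \<Rightarrow> real) \<Rightarrow> real
      \<Rightarrow> ('a \<Rightarrow> real) \<Rightarrow> real \<Rightarrow> real" where
  "sav_N_tilde \<Omega> G \<epsilon> F C\<^sub>0 u r =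
     1 / (2 * sqrt (potential_int \<Omega> F u + C\<^sub>0))
       * L2_inner \<Omega> (\<lambda>x. deriv F (u x)) (\<lambda>x. sav_L G \<epsilon> u x + sav_N \<Omega> G F C\<^sub>0 u r x)"

definition sav_energy ::
    "'a::euclidean_space set \<Rightarrow> real \<Rightarrow> real \<Rightarrow> ('a \<Rightarrow> real) \<Rightarrow> real \<Rightarrow> real" where
  "sav_energy \<Omega> \<epsilon> C\<^sub>0 u r = \<epsilon>\<^sup>2 / 2 * (L2_norm \<Omega> (gradient u))\<^sup>2 + r\<^sup>2 - C\<^sub>0"

end

theory Submission
  imports Defs
begin

text \<open>The energy increment is quadratic in \<open>\<gamma>\<close>. When \<open>D\<close> is nonzero, the relaxation
  coefficient is chosen so that the second-order part \<open>\<gamma>\<^sup>2 \<tau>\<^sup>2 D\<close> replaces \<open>u, r\<close>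
  in the first-order part by the stage values. What remains is
  \<open>\<gamma> \<tau> \<Sum> b\<^sub>i \<langle>\<mu>\<^sub>i, G \<mu>\<^sub>i\<rangle>\<close>, where \<open>\<mu>\<^sub>i\<close> is the chemical potential of stage
  \<open>i\<close>, and this is nonpositive because \<open>G\<close> is. When \<open>D = 0\<close>, the energy does not change.
  The analytic input is Green's identity for periodic functions, which follows from Fubini
  and the fundamental theorem of calculus.\<close>

section \<open>Calculus of partial derivatives\<close>

lemma pdiff_eqI: "(u has_derivative u') (at x) \<Longrightarrow> pdiff i u x = u' i"
  unfolding pdiff_def by (metis frechet_derivative_at)

lemma has_derivative_frechet:
  "u differentiable (at x) \<Longrightarrow> (u has_derivative frechet_derivative u (at x)) (at x)"
  using frechet_derivative_works by blast

lemma pdiff_add: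
  assumes "u differentiable (at x)" "v differentiable (at x)"
  shows "pdiff i (\<lambda>x. u x + v x) x = pdiff i u x + pdiff i v x"
  using pdiff_eqI[OF has_derivative_add[OF assms[THEN has_derivative_frechet]]]
  by (simp add: pdiff_def)

lemma pdiff_cmult:
  assumes "u differentiable (at x)"
  shows "pdiff i (\<lambda>x. c * u x) x = c * pdiff i u x"
  using pdiff_eqI[OF has_derivative_mult_right[OF has_derivative_frechet[OF assms]]]
  by (simp add: pdiff_def)

lemma pdiff_mult:
  assumes "u differentiable (at x)" "v differentiable (at x)"
  shows "pdiff i (\<lambda>x. u x * v x) x = u x * pdiff i v x + pdiff i u x * v x"
  using pdiff_eqI[OF has_derivative_mult[OF assms[THEN has_derivative_frechet]]]
  by (simp add: pdiff_def)

lemma pdiff_compose: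
  assumes "f differentiable (at (u x))" "u differentiable (at x)"
  shows "pdiff i (\<lambda>x. f (u x)) x = deriv f (u x) * pdiff i u x"
proof -
  have "(f has_field_derivative deriv f (u x)) (at (u x))"
    using assms(1) by (simp add: DERIV_deriv_iff_real_differentiable)
  from pdiff_eqI[OF DERIV_compose_FDERIV[OF this has_derivative_frechet[OF assms(2)]]]
  show ?thesis by (simp add: pdiff_def mult.commute)
qed

section \<open>Closure properties of the classes \<open>C_k\<close>\<close>

lemma C_k_Suc_D: "C_k (Suc k) u \<Longrightarrow> C_k k u"
proof (induction k arbitrary: u)
  case 0
  then show ?case
    by (auto intro!: continuous_at_imp_continuous_on differentiable_imp_continuous_within)
qed auto

lemma C_k_const: "C_k k (\<lambda>x. c)"
proof (induction k arbitrary: c)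
  case (Suc k)
  have "pdiff i (\<lambda>x::'a. c) = (\<lambda>x. 0)" for i
    by (rule ext, rule pdiff_eqI) simp
  with Suc show ?case by auto
qed simp

lemma C_k_add: "C_k k u \<Longrightarrow> C_k k v \<Longrightarrow> C_k k (\<lambda>x. u x + v x)"
proof (induction k arbitrary: u v)
  case (Suc k)
  then have "pdiff i (\<lambda>x. u x + v x) = (\<lambda>x. pdiff i u x + pdiff i v x)" for i
    by (auto simp: pdiff_add)
  with Suc show ?case by auto
qed (auto intro: continuous_on_add)

text \<open>The product rule writes each partial derivative as a sum of products in which one factor
  is differentiated and the other is not. The undifferentiated factor is demoted by
  \<open>C_k_Suc_D\<close> so that the induction hypothesis applies.\<close>

lemma C_k_mult: "C_k k u \<Longrightarrow> C_k k v \<Longrightarrow> C_k k (\<lambda>x. u x * v x)"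
proof (induction k arbitrary: u v)
  case (Suc k)
  then have "pdiff i (\<lambda>x. u x * v x) = (\<lambda>x. u x * pdiff i v x + pdiff i u x * v x)" for i
    by (auto simp: pdiff_mult)
  with Suc C_k_Suc_D[of k u] C_k_Suc_D[of k v] show ?case
    by (auto intro!: C_k_add)
qed (auto intro: continuous_on_mult)

lemma C_k_cmult: "C_k k u \<Longrightarrow> C_k k (\<lambda>x. c * u x)"
  using C_k_mult[OF C_k_const] .

lemma C_k_sum: "(\<And>i. i \<in> I \<Longrightarrow> C_k k (h i)) \<Longrightarrow> C_k k (\<lambda>x. \<Sum>i\<in>I. h i x)"
  by (induction I rule: infinite_finite_induct) (auto intro: C_k_const C_k_add)

lemma smooth_real_deriv: "smooth_real f \<Longrightarrow> smooth_real (deriv f)"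
  unfolding smooth_real_def by (metis comp_apply funpow_Suc_right)

lemma smooth_real_differentiable: "smooth_real f \<Longrightarrow> f differentiable (at x)"
  unfolding smooth_real_def by (metis funpow_0)

text \<open>The chain rule replaces \<open>f\<close> by \<open>deriv f\<close>, so the induction
  must range over all smooth \<open>f\<close>; smoothness is stable under
  \<open>deriv\<close>.\<close>

lemma C_k_compose: "smooth_real f \<Longrightarrow> C_k k u \<Longrightarrow> C_k k (\<lambda>x. f (u x))"
proof (induction k arbitrary: f u)
  case 0
  then have "continuous_on UNIV f"
    by (auto intro!: continuous_at_imp_continuous_on differentiable_imp_continuous_within
        smooth_real_differentiable)
  with 0 show ?case by (auto intro: continuous_on_compose2)
next
  case (Suc k)
  then have "pdiff i (\<lambda>x. f (u x)) = (\<lambda>x. deriv f (u x) * pdiff i u x)" for i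
    by (auto simp: pdiff_compose smooth_real_differentiable)
  moreover have "(\<lambda>x. f (u x)) differentiable (at x)" for x
    using differentiable_chain_at[of u x f] Suc.prems
    by (auto simp: smooth_real_differentiable o_def)
  ultimately show ?case
    using Suc.prems Suc.IH[OF smooth_real_deriv[OF Suc.prems(1)] C_k_Suc_D[OF Suc.prems(2)]]
    by (auto intro!: C_k_mult)
qed

lemma C_k_continuous: "C_k k u \<Longrightarrow> continuous_on UNIV u"
  by (cases k)
    (auto intro!: continuous_at_imp_continuous_on differentiable_imp_continuous_within)

lemma C_1_D:
  assumes "C_k 1 u"
  shows "u differentiable (at x)" "i \<in> Basis \<Longrightarrow> continuous_on UNIV (pdiff i u)"
  using assms by auto

lemma C_2_D:
  assumes "C_k 2 u"
  shows "C_k 1 u" "i \<in> Basis \<Longrightarrow> C_k 1 (pdiff i u)"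
  using assms C_k_Suc_D[of 1 u] by (auto simp: numeral_2_eq_2)

section \<open>Continuity and linearity of the gradient and the Laplacian\<close>

lemma continuous_gradient: "C_k 1 u \<Longrightarrow> continuous_on UNIV (gradient u)"
  unfolding gradient_def
  by (intro continuous_on_sum continuous_on_scaleR continuous_on_const C_1_D)

lemma continuous_laplacian: "C_k 2 u \<Longrightarrow> continuous_on UNIV (laplacian u)"
  unfolding laplacian_def
  by (intro continuous_on_sum C_1_D(2) C_2_D(2))

lemma gradient_add:
  assumes "C_k 1 u" "C_k 1 v"
  shows "gradient (\<lambda>x. u x + v x) = (\<lambda>x. gradient u x + gradient v x)"
  using C_1_D(1)[OF assms(1)] C_1_D(1)[OF assms(2)]
  by (auto simp: gradient_def pdiff_add scaleR_add_left sum.distrib)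

lemma gradient_cmult:
  assumes "C_k 1 u"
  shows "gradient (\<lambda>x. c * u x) = (\<lambda>x. c *\<^sub>R gradient u x)"
  using C_1_D(1)[OF assms] by (auto simp: gradient_def pdiff_cmult scaleR_sum_right)

lemma laplacian_add:
  assumes "C_k 2 u" "C_k 2 v"
  shows "laplacian (\<lambda>x. u x + v x) = (\<lambda>x. laplacian u x + laplacian v x)"
proof -
  have "pdiff i (\<lambda>x. u x + v x) = (\<lambda>x. pdiff i u x + pdiff i v x)" for i
    using C_1_D(1)[OF C_2_D(1)[OF assms(1)]] C_1_D(1)[OF C_2_D(1)[OF assms(2)]]
    by (auto simp: pdiff_add)
  moreover have "pdiff i (\<lambda>x. pdiff i u x + pdiff i v x) x
      = pdiff i (pdiff i u) x + pdiff i (pdiff i v) x" if "i \<in> Basis" for i x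
    using C_1_D(1)[OF C_2_D(2)[OF assms(1) that]] C_1_D(1)[OF C_2_D(2)[OF assms(2) that]]
    by (simp add: pdiff_add)
  ultimately show ?thesis by (auto simp: laplacian_def sum.distrib)
qed

lemma laplacian_cmult:
  assumes "C_k 2 u"
  shows "laplacian (\<lambda>x. c * u x) = (\<lambda>x. c * laplacian u x)"
proof -
  have "pdiff i (\<lambda>x. c * u x) = (\<lambda>x. c * pdiff i u x)" for i
    using C_1_D(1)[OF C_2_D(1)[OF assms]] by (auto simp: pdiff_cmult)
  moreover have "pdiff i (\<lambda>x. c * pdiff i u x) x = c * pdiff i (pdiff i u) x"
    if "i \<in> Basis" for i x
    using C_1_D(1)[OF C_2_D(2)[OF assms that]] by (simp add: pdiff_cmult)
  ultimately show ?thesis by (auto simp: laplacian_def sum_distrib_left)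
qed

section \<open>Periodic functions\<close>

lemma periodic_box_pdiff:
  assumes "periodic_box lo hi u"
  shows "periodic_box lo hi (pdiff i u)"
proof -
  have "frechet_derivative u (at (x + c)) = frechet_derivative u (at x)"
    if c: "\<And>y. u (y + c) = u y" for c x
  proof -
    \<comment> \<open>Translation by the period carries derivatives at one point to the other, in
      both directions. Since \<open>frechet_derivative\<close> is a choice from the
      \<open>has_derivative\<close> predicate, equal predicates give equal choices, whether or not
      \<open>u\<close> is differentiable there.\<close>
    have "(u has_derivative f) (at (x + c)) \<longleftrightarrow> (u has_derivative f) (at x)" for f
    proof
      assume "(u has_derivative f) (at (x + c))"
      moreover have "((\<lambda>y. y + c) has_derivative (\<lambda>y. y)) (at x)"
        by (auto intro!: derivative_eq_intros)
      ultimately have "((\<lambda>y. u (y + c)) has_derivative f) (at x)"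
        by (rule has_derivative_compose[rotated])
      then show "(u has_derivative f) (at x)" by (simp add: c)
    next
      assume "(u has_derivative f) (at x)"
      then have "(u has_derivative f) (at ((x + c) - c))" by simp
      moreover have "((\<lambda>y. y - c) has_derivative (\<lambda>y. y)) (at (x + c))"
        by (auto intro!: derivative_eq_intros)
      ultimately have "((\<lambda>y. u (y - c)) has_derivative f) (at (x + c))"
        by (rule has_derivative_compose[rotated])
      moreover have "u (y - c) = u y" for y
        using c[of "y - c"] by simp
      ultimately show "(u has_derivative f) (at (x + c))" by simp
    qed
    then show ?thesis by (simp add: frechet_derivative_def)
  qed
  with assms show ?thesis by (auto simp: periodic_box_def pdiff_def)
qed

lemma periodic_box_laplacian: "periodic_box lo hi u \<Longrightarrow> periodic_box lo hi (laplacian u)"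
  using periodic_box_pdiff[OF periodic_box_pdiff[of lo hi u]]
  by (auto simp: periodic_box_def laplacian_def intro!: sum.cong)

section \<open>Integration over one period cell\<close>

lemma set_integrable_box:
  fixes f :: "'a::euclidean_space \<Rightarrow> real"
  assumes "continuous_on UNIV f"
  shows "set_integrable lborel (box lo hi) f"
proof -
  have "set_integrable lborel (cbox lo hi) f"
    unfolding set_integrable_def
    by (rule borel_integrable_compact) (auto intro: continuous_on_subset[OF assms])
  then show ?thesis
    by (rule set_integrable_subset) (auto simp: box_subset_cbox)
qed

text \<open>By Fubini, integrate first in direction \<open>i\<close>. On each line the fundamental
  theorem leaves the difference of \<open>g\<close> at two opposite faces, which periodicity makes
  zero.\<close>

lemma integral_pdiff_periodic:
  fixes g :: "'a::euclidean_space \<Rightarrow> real"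
  assumes box: "\<forall>i\<in>Basis. lo \<bullet> i < hi \<bullet> i" and per: "periodic_box lo hi g"
    and g: "C_k 1 g" and i: "i \<in> Basis"
  shows "(LINT x:box lo hi|lborel. pdiff i g x) = 0"
proof -
  interpret product_sigma_finite "\<lambda>_::'a. lborel :: real measure" ..
  \<comment> \<open>\<open>\<Phi>\<close> assembles a vector from its coordinates; Lebesgue measure
    is the image under it of the product of one-dimensional measures. \<open>P\<close> is the
    integrand extended by zero, so that each slice integral runs over the whole line.\<close>
  define \<Phi> where "\<Phi> f = (\<Sum>b\<in>Basis. f b *\<^sub>R b)" for f :: "'a \<Rightarrow> real"
  define P where "P = (\<lambda>x. indicator (box lo hi) x *\<^sub>R pdiff i g x)"
  have \<Phi>[measurable]: "\<Phi> \<in> measurable (\<Pi>\<^sub>M b\<in>Basis. lborel) borel"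
    unfolding \<Phi>_def by measurable
  have lb: "(lborel :: 'a measure) = distr (\<Pi>\<^sub>M b\<in>Basis. lborel) borel \<Phi>"
    unfolding \<Phi>_def by (rule lborel_eq)
  have int: "integrable lborel P"
    using set_integrable_box[OF C_1_D(2)[OF g i], of lo hi] by (simp add: P_def set_integrable_def)
  then have [measurable]: "P \<in> borel_measurable borel" by auto
  \<comment> \<open>Splitting off coordinate \<open>i\<close> puts the product in the shape required
    by the Fubini rule.\<close>
  have B: "insert i (Basis - {i}) = (Basis :: 'a set)" using i by auto
  have slice: "(LINT y|lborel. P (\<Phi> (f(i := y)))) = 0" for f
  proof -
    \<comment> \<open>\<open>z\<close> is the point with coordinate \<open>i\<close> equal to zero
      on the line to be integrated along, so the line is \<open>z + y *\<^sub>R i\<close>.\<close>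
    define z where "z = \<Phi> (f(i := 0))"
    have zi: "z \<bullet> j = (if j = i then 0 else f j)" if "j \<in> Basis" for j
      using that by (simp add: z_def \<Phi>_def inner_sum_left_Basis)
    have \<Phi>y: "\<Phi> (f(i := y)) = z + y *\<^sub>R i" for y
      using i by (intro euclidean_eqI[where 'a = 'a])
        (auto simp: zi \<Phi>_def inner_sum_left_Basis inner_add_left inner_Basis)
    have mem: "z + y *\<^sub>R i \<in> box lo hi \<longleftrightarrow> y \<in> {lo \<bullet> i<..<hi \<bullet> i} \<and>
        (\<forall>j\<in>Basis - {i}. lo \<bullet> j < f j \<and> f j < hi \<bullet> j)" for y
      using i by (auto simp: mem_box inner_add_left inner_Basis zi split: if_splits)
    show ?thesis
    proof (cases "\<forall>j\<in>Basis - {i}. lo \<bullet> j < f j \<and> f j < hi \<bullet> j")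
      \<comment> \<open>The line misses the box, so the integrand vanishes along it.\<close>
      case False
      then have "P (\<Phi> (f(i := y))) = 0" for y
        unfolding \<Phi>y P_def using mem by (simp add: indicator_def)
      then show ?thesis by simp
    next
      case True
      have der: "((\<lambda>y. g (z + y *\<^sub>R i)) has_real_derivative pdiff i g (z + y *\<^sub>R i)) (at y)" for y
      proof -
        let ?D = "frechet_derivative g (at (z + y *\<^sub>R i))"
        have D: "(g has_derivative ?D) (at (z + y *\<^sub>R i))"
          using has_derivative_frechet C_1_D(1)[OF g] .
        have "((\<lambda>y. g (z + y *\<^sub>R i)) has_derivative (\<lambda>t. ?D (t *\<^sub>R i))) (at y)"
          by (rule has_derivative_compose[where f = "\<lambda>y. z + y *\<^sub>R i", OF _ D])
            (auto intro!: derivative_eq_intros)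
        moreover have "(\<lambda>t. ?D (t *\<^sub>R i)) = (\<lambda>t. pdiff i g (z + y *\<^sub>R i) * t)"
          using linear_scale[OF has_derivative_linear[OF D]] by (auto simp: pdiff_def)
        ultimately show ?thesis by (simp add: has_field_derivative_def)
      qed
      have cont_on: "continuous_on UNIV (\<lambda>y. pdiff i g (z + y *\<^sub>R i))"
        by (rule continuous_on_compose2[OF C_1_D(2)[OF g i]]) (auto intro!: continuous_intros)
      then have cont: "isCont (\<lambda>y. pdiff i g (z + y *\<^sub>R i)) y" for y
        by (simp add: continuous_on_eq_continuous_at)
      have le: "lo \<bullet> i \<le> hi \<bullet> i" using box i by (auto intro: less_imp_le)
      \<comment> \<open>The line meets the box in an open interval, while the fundamental theorem is
        stated for the closed one; they differ by two points, a null set.\<close>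
      have "(LINT y|lborel. P (\<Phi> (f(i := y))))
          = (LINT y|lborel. pdiff i g (z + y *\<^sub>R i) * indicator {lo \<bullet> i..hi \<bullet> i} y)"
      proof (rule integral_cong_AE)
        have "AE y in lborel. y \<noteq> lo \<bullet> i" "AE y in lborel. y \<noteq> hi \<bullet> i"
          by (rule AE_lborel_singleton)+
        then show "AE y in lborel. P (\<Phi> (f(i := y)))
            = pdiff i g (z + y *\<^sub>R i) * indicator {lo \<bullet> i..hi \<bullet> i} y"
          by eventually_elim (use True mem in \<open>auto simp: \<Phi>y P_def indicator_def\<close>)
        show "(\<lambda>y. P (\<Phi> (f(i := y)))) \<in> borel_measurable lborel"
          unfolding \<Phi>y by measurable
        have [measurable]: "(\<lambda>y. pdiff i g (z + y *\<^sub>R i)) \<in> borel_measurable borel"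
          using cont_on by (rule borel_measurable_continuous_onI)
        show "(\<lambda>y. pdiff i g (z + y *\<^sub>R i) * indicator {lo \<bullet> i..hi \<bullet> i} y)
            \<in> borel_measurable lborel" by measurable
      qed
      also have "\<dots> = g (z + (hi \<bullet> i) *\<^sub>R i) - g (z + (lo \<bullet> i) *\<^sub>R i)"
        by (rule integral_FTC_Icc_real[OF le der cont])
      also have "z + (hi \<bullet> i) *\<^sub>R i = z + (lo \<bullet> i) *\<^sub>R i + ((hi - lo) \<bullet> i) *\<^sub>R i"
        by (simp add: algebra_simps)
      also have "g \<dots> = g (z + (lo \<bullet> i) *\<^sub>R i)"
        using per i by (simp only: periodic_box_def)
      finally show ?thesis by (simp only: diff_self)
    qed
  qed
  \<comment> \<open>Integrability is transported to the product space to justify Fubini with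
    coordinate \<open>i\<close> innermost.\<close>
  have "integrable (distr (\<Pi>\<^sub>M b\<in>Basis. lborel) borel \<Phi>) P"
    using int lb by simp
  then have "integrable (Pi\<^sub>M (insert i (Basis - {i})) (\<lambda>_. lborel)) (\<lambda>f. P (\<Phi> f))"
    unfolding B by (simp add: integrable_distr_eq)
  then have "(LINT f|Pi\<^sub>M (insert i (Basis - {i})) (\<lambda>_. lborel). P (\<Phi> f))
      = (LINT f|Pi\<^sub>M (Basis - {i}) (\<lambda>_. lborel). LINT y|lborel. P (\<Phi> (f(i := y))))"
    by (intro product_integral_insert) auto
  then have "(LINT f|Pi\<^sub>M Basis (\<lambda>_. lborel). P (\<Phi> f)) = 0"
    by (simp only: B slice integral_zero)
  moreover have "integral\<^sup>L lborel P = (LINT f|Pi\<^sub>M Basis (\<lambda>_. lborel). P (\<Phi> f))"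
    by (subst lb, rule integral_distr) simp_all
  ultimately show ?thesis
    by (simp add: P_def set_lebesgue_integral_def)
qed

section \<open>The inner product and Green's identity\<close>

lemma L2_inner_commute: "L2_inner \<Omega> f g = L2_inner \<Omega> g f"
  by (simp add: L2_inner_def inner_commute)

lemma L2_inner_add_right:
  assumes "continuous_on UNIV f" "continuous_on UNIV g" "continuous_on UNIV h"
  shows "L2_inner (box lo hi) f (\<lambda>x. g x + h x) = L2_inner (box lo hi) f g + L2_inner (box lo hi) f h"
  unfolding L2_inner_def inner_add_right
  by (intro set_integral_add set_integrable_box continuous_intros assms)

lemma L2_inner_cmult_right: "L2_inner \<Omega> f (\<lambda>x. c *\<^sub>R g x) = c * L2_inner \<Omega> f g"
  by (simp add: L2_inner_def)

lemma L2_inner_nonneg: "L2_inner \<Omega> f f \<ge> 0"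
  unfolding L2_inner_def set_lebesgue_integral_def
  by (intro Bochner_Integration.integral_nonneg) (simp add: indicator_def)

lemma L2_norm_power2: "(L2_norm \<Omega> f)\<^sup>2 = L2_inner \<Omega> f f"
  by (simp add: L2_norm_def L2_inner_nonneg)

text \<open>The degenerate case of Cauchy-Schwarz: if \<open>g\<close> has norm zero, the squared
  norm of f + t g is affine in t, and an affine function that is nonnegative for all t has slope
  zero. It serves the case \<open>D = 0\<close> of the energy estimate.\<close>

lemma L2_inner_eq_0_right:
  assumes f: "continuous_on UNIV f" and g: "continuous_on UNIV g"
    and 0: "L2_inner (box lo hi) g g = 0"
  shows "L2_inner (box lo hi) f g = 0"
proof -
  have *: "0 \<le> L2_inner (box lo hi) f f + 2 * t * L2_inner (box lo hi) f g" for t :: real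
  proof -
    let ?h = "\<lambda>x. f x + t *\<^sub>R g x"
    have h: "continuous_on UNIV ?h" "continuous_on UNIV (\<lambda>x. t *\<^sub>R g x)"
      by (intro continuous_on_add continuous_on_scaleR continuous_on_const f g)+
    have "L2_inner (box lo hi) ?h ?h = L2_inner (box lo hi) ?h f + t * L2_inner (box lo hi) ?h g"
      by (subst L2_inner_add_right[OF h(1) f h(2)]) (simp only: L2_inner_cmult_right)
    also have "\<dots> = L2_inner (box lo hi) f ?h + t * L2_inner (box lo hi) g ?h"
      by (simp only: L2_inner_commute[of _ ?h f] L2_inner_commute[of _ ?h g])
    also have "L2_inner (box lo hi) f ?h = L2_inner (box lo hi) f f + t * L2_inner (box lo hi) f g"
      by (simp add: L2_inner_add_right[OF f f h(2)] L2_inner_cmult_right)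
    also have "L2_inner (box lo hi) g ?h = L2_inner (box lo hi) f g"
      by (simp add: L2_inner_add_right[OF g f h(2)] L2_inner_cmult_right 0 L2_inner_commute[of _ g f])
    finally show ?thesis using L2_inner_nonneg[of "box lo hi" ?h] by (simp add: algebra_simps)
  qed
  show ?thesis
  proof (rule ccontr)
    assume "L2_inner (box lo hi) f g \<noteq> 0"
    \<comment> \<open>This t is chosen to make the affine function equal to -1.\<close>
    with *[of "- (L2_inner (box lo hi) f f + 1) / (2 * L2_inner (box lo hi) f g)"]
    show False by (simp add: field_simps)
  qed
qed

text \<open>Integration by parts: for each \<open>i\<close>, the product
  \<open>w x * pdiff i v x\<close> is periodic and \<open>C_k 1\<close>, so its \<open>i\<close>-th
  partial derivative integrates to zero. Summing over the basis gives the identity without boundary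
  terms.\<close>

lemma green_periodic:
  assumes box: "\<forall>i\<in>Basis. lo \<bullet> i < hi \<bullet> i"
    and w: "C_k 1 w" "periodic_box lo hi w" and v: "C_k 2 v" "periodic_box lo hi v"
  shows "L2_inner (box lo hi) w (laplacian v) = - L2_inner (box lo hi) (gradient w) (gradient v)"
proof -
  have parts: "(LINT x:box lo hi|lborel. w x * pdiff i (pdiff i v) x + pdiff i w x * pdiff i v x) = 0"
    if i: "i \<in> Basis" for i
  proof -
    have vi: "C_k 1 (pdiff i v)" using C_2_D(2)[OF v(1) i] .
    have "pdiff i (\<lambda>x. w x * pdiff i v x)
        = (\<lambda>x. w x * pdiff i (pdiff i v) x + pdiff i w x * pdiff i v x)"
      using C_1_D(1)[OF w(1)] C_1_D(1)[OF vi] by (auto simp: pdiff_mult)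
    moreover have "periodic_box lo hi (\<lambda>x. w x * pdiff i v x)"
      using w(2) periodic_box_pdiff[OF v(2)] by (simp add: periodic_box_def)
    ultimately show ?thesis
      using integral_pdiff_periodic[OF box _ C_k_mult[OF w(1) vi] i] by simp
  qed
  have gg: "gradient w x \<bullet> gradient v x = (\<Sum>i\<in>Basis. pdiff i w x * pdiff i v x)" for x
    by (subst euclidean_inner) (simp add: gradient_def inner_sum_left_Basis)
  have "L2_inner (box lo hi) w (laplacian v) + L2_inner (box lo hi) (gradient w) (gradient v)
      = (LINT x:box lo hi|lborel. w x \<bullet> laplacian v x + gradient w x \<bullet> gradient v x)"
    unfolding L2_inner_def
    by (intro set_integral_add(2)[symmetric] set_integrable_box continuous_intros
        continuous_gradient continuous_laplacian C_k_continuous[OF w(1)] w v C_2_D)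
  also have "\<dots> = (LINT x:box lo hi|lborel.
      (\<Sum>i\<in>Basis. w x * pdiff i (pdiff i v) x + pdiff i w x * pdiff i v x))"
    by (simp add: gg laplacian_def sum.distrib sum_distrib_left)
  also have "\<dots> = (\<Sum>i\<in>Basis. LINT x:box lo hi|lborel.
      w x * pdiff i (pdiff i v) x + pdiff i w x * pdiff i v x)"
    unfolding set_lebesgue_integral_def scaleR_sum_right
    by (intro Bochner_Integration.integral_sum set_integrable_box[unfolded set_integrable_def]
        continuous_intros C_k_continuous[OF w(1)] C_1_D(2) C_2_D(2) C_2_D(1) w v)
  also have "\<dots> = 0" by (simp add: parts)
  finally show ?thesis by simp
qed

lemma L2_inner_gradient_sum_right:
  assumes f: "C_k 1 f" and h: "\<And>i. i \<in> I \<Longrightarrow> C_k 1 (h i)"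
  shows "L2_inner (box lo hi) (gradient f) (gradient (\<lambda>x. \<Sum>i\<in>I. c i * h i x))
      = (\<Sum>i\<in>I. c i * L2_inner (box lo hi) (gradient f) (gradient (h i)))"
  using h
proof (induction I rule: infinite_finite_induct)
  case (insert i I)
  have hi: "C_k 1 (h i)" and s: "C_k 1 (\<lambda>x. \<Sum>i\<in>I. c i * h i x)"
    using insert.prems by (auto intro!: C_k_sum C_k_cmult simp del: C_k.simps One_nat_def)
  have "L2_inner (box lo hi) (gradient f) (gradient (\<lambda>x. c i * h i x + (\<Sum>i\<in>I. c i * h i x)))
     = c i * L2_inner (box lo hi) (gradient f) (gradient (h i))
       + L2_inner (box lo hi) (gradient f) (gradient (\<lambda>x. \<Sum>i\<in>I. c i * h i x))"
    unfolding gradient_add[OF C_k_cmult[OF hi] s]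
      L2_inner_add_right[OF continuous_gradient[OF f] continuous_gradient[OF C_k_cmult[OF hi]]
        continuous_gradient[OF s]]
    by (simp add: gradient_cmult[OF hi] L2_inner_cmult_right)
  with insert show ?case by simp
\<comment> \<open>Empty and infinite index sets both give the zero function, whose gradient
  vanishes.\<close>
qed (simp_all add: gradient_def pdiff_def L2_inner_def frechet_derivative_const)

section \<open>The operators of the gradient flow\<close>

lemma flow_op_add:
  assumes "G = allen_cahn_op \<or> G = cahn_hilliard_op" "C_k 2 f" "C_k 2 g"
  shows "G (\<lambda>x. f x + g x) = (\<lambda>x. G f x + G g x)"
  using assms by (auto simp: allen_cahn_op_def cahn_hilliard_op_def laplacian_add)

lemma periodic_box_flow_op:
  assumes "G = allen_cahn_op \<or> G = cahn_hilliard_op" "periodic_box lo hi f"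
  shows "periodic_box lo hi (G f)"
  using assms periodic_box_laplacian[of lo hi f]
  by (auto simp: allen_cahn_op_def cahn_hilliard_op_def) (simp add: periodic_box_def)

text \<open>The pairing is minus the squared norm of \<open>f\<close> for Allen-Cahn and, by Green's
  identity, minus that of its gradient for Cahn-Hilliard.\<close>

lemma flow_op_nonpos:
  assumes "\<forall>i\<in>Basis. lo \<bullet> i < hi \<bullet> i" "G = allen_cahn_op \<or> G = cahn_hilliard_op"
    and "C_k 2 f" "periodic_box lo hi f"
  shows "L2_inner (box lo hi) f (G f) \<le> 0"
  using assms(2)
proof
  assume "G = allen_cahn_op"
  then have "G f = (\<lambda>x. (- 1) *\<^sub>R f x)" by (auto simp: allen_cahn_op_def)
  then show ?thesis
    using L2_inner_nonneg[of "box lo hi" f] by (simp only: L2_inner_cmult_right)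
next
  assume "G = cahn_hilliard_op"
  then show ?thesis
    using green_periodic[OF assms(1) C_2_D(1)[OF assms(3)] assms(4,3,4)]
      L2_inner_nonneg[of "box lo hi" "gradient f"]
    by (simp add: cahn_hilliard_op_def)
qed

text \<open>The left side of the inequality is the derivative of the energy at (\<open>U\<close>,
  \<open>R\<close>) along the SAV vector field. It equals the pairing of the chemical potential
  \<open>\<mu>\<close> with \<open>G \<mu>\<close>, so the sign of \<open>G\<close> decides.\<close>

lemma sav_stage_dissipation:
  fixes F :: "real \<Rightarrow> real" and lo hi :: "'a::euclidean_space" and \<epsilon> C\<^sub>0 R :: real
  assumes box: "\<forall>i\<in>Basis. lo \<bullet> i < hi \<bullet> i"
    and G: "G = allen_cahn_op \<or> G = cahn_hilliard_op" and F: "smooth_real F"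
    and U: "C_k 2 U" "C_k 2 (laplacian U)" "periodic_box lo hi U"
  defines "H \<equiv> \<lambda>x. sav_L G \<epsilon> U x + sav_N (box lo hi) G F C\<^sub>0 U R x"
  assumes H: "C_k 1 H"
  shows "periodic_box lo hi H"
    and "\<epsilon>\<^sup>2 * L2_inner (box lo hi) (gradient U) (gradient H)
      + 2 * R * sav_N_tilde (box lo hi) G \<epsilon> F C\<^sub>0 U R \<le> 0"
proof -
  define q where "q = sqrt (potential_int (box lo hi) F U + C\<^sub>0)"
  define \<mu> where "\<mu> = (\<lambda>x. - \<epsilon>\<^sup>2 * laplacian U x + R / q * deriv F (U x))"
  have F': "C_k 2 (\<lambda>x. deriv F (U x))" by (rule C_k_compose[OF smooth_real_deriv[OF F] U(1)])
  have \<mu>1: "C_k 2 (\<lambda>x. - \<epsilon>\<^sup>2 * laplacian U x)" and \<mu>2: "C_k 2 (\<lambda>x. R / q * deriv F (U x))"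
    by (rule C_k_cmult[OF U(2)], rule C_k_cmult[OF F'])
  have \<mu>: "C_k 2 \<mu>" unfolding \<mu>_def by (rule C_k_add[OF \<mu>1 \<mu>2])
  have H_eq: "H = G \<mu>"
    unfolding H_def \<mu>_def flow_op_add[OF G \<mu>1 \<mu>2] by (simp add: sav_L_def sav_N_def q_def)
  have per: "periodic_box lo hi \<mu>"
    using U(3) periodic_box_laplacian[OF U(3)] by (simp add: \<mu>_def periodic_box_def)
  then show perH: "periodic_box lo hi H"
    unfolding H_eq by (rule periodic_box_flow_op[OF G])
  have cH: "continuous_on UNIV H" by (rule C_k_continuous[OF H])
  have "L2_inner (box lo hi) H \<mu> = - \<epsilon>\<^sup>2 * L2_inner (box lo hi) H (laplacian U)
      + R / q * L2_inner (box lo hi) H (\<lambda>x. deriv F (U x))"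
    unfolding \<mu>_def L2_inner_add_right[OF cH C_k_continuous[OF \<mu>1] C_k_continuous[OF \<mu>2]]
    by (simp only: L2_inner_cmult_right real_scaleR_def[symmetric])
  \<comment> \<open>Green's identity with \<open>H\<close> as the once differentiable factor turns
    the diffusion part into the gradient pairing.\<close>
  also have "L2_inner (box lo hi) H (laplacian U)
      = - L2_inner (box lo hi) (gradient U) (gradient H)"
    using green_periodic[OF box H perH U(1,3)] by (simp add: L2_inner_commute)
  \<comment> \<open>The factor 2 from differentiating \<open>r\<^sup>2\<close> cancels the 1/2 in
    \<open>sav_N_tilde\<close>.\<close>
  also have "R / q * L2_inner (box lo hi) H (\<lambda>x. deriv F (U x))
      = 2 * R * sav_N_tilde (box lo hi) G \<epsilon> F C\<^sub>0 U R"
    by (simp add: sav_N_tilde_def q_def H_def L2_inner_commute)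
  finally show "\<epsilon>\<^sup>2 * L2_inner (box lo hi) (gradient U) (gradient H)
      + 2 * R * sav_N_tilde (box lo hi) G \<epsilon> F C\<^sub>0 U R \<le> 0"
    using flow_op_nonpos[OF box G \<mu> per] by (simp add: H_eq L2_inner_commute)
qed

section \<open>Energy decay\<close>

theorem theorem2p1:
  fixes lo hi :: "'a::euclidean_space" and \<Omega> :: "'a set"
    and G :: "('a \<Rightarrow> real) \<Rightarrow> 'a \<Rightarrow> real"
    and F :: "real \<Rightarrow> real" and \<epsilon> C\<^sub>0 :: real
    and s :: nat and a a' :: "nat \<Rightarrow> nat \<Rightarrow> real" and b b' :: "nat \<Rightarrow> real"
    and \<tau> \<gamma> D :: real
    and u u_new :: "'a \<Rightarrow> real" and r r_new :: real
    and U L N :: "nat \<Rightarrow> 'a \<Rightarrow> real" and R N' :: "nat \<Rightarrow> real"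
  assumes domain: "\<forall>i\<in>Basis. lo \<bullet> i < hi \<bullet> i" "\<Omega> = box lo hi"
    and operator: "G = allen_cahn_op \<or> G = cahn_hilliard_op"
    and params: "\<epsilon> > 0" "C\<^sub>0 \<ge> 0" "\<tau> > 0"
    and potential: "smooth_real F"
      "\<forall>i\<in>{1..s}. potential_int \<Omega> F (U i) + C\<^sub>0 > 0"
    and coefficients: "\<forall>i\<in>{1..s}. \<forall>j\<in>{1..s}. j > i \<longrightarrow> a i j = 0"
      "\<forall>i\<in>{1..s}. \<forall>j\<in>{1..s}. j \<ge> i \<longrightarrow> a' i j = 0"
      "(\<Sum>i=1..s. b i) = 1" "(\<Sum>i=1..s. b' i) = 1"
    and rhs: "\<forall>i\<in>{1..s}. L i = sav_L G \<epsilon> (U i)"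
      "\<forall>i\<in>{1..s}. N i = sav_N \<Omega> G F C\<^sub>0 (U i) (R i)"
      "\<forall>i\<in>{1..s}. N' i = sav_N_tilde \<Omega> G \<epsilon> F C\<^sub>0 (U i) (R i)"
    and periodic: "periodic_box lo hi u" "\<forall>i\<in>{1..s}. periodic_box lo hi (U i)"
    and regular: "C_k 1 u"
      "\<forall>i\<in>{1..s}. C_k 2 (U i) \<and> C_k 2 (laplacian (U i)) \<and> C_k 2 (L i) \<and> C_k 2 (N i)"
    and stages:
      "\<forall>i\<in>{1..s}. \<forall>x. U i x = u x + \<tau> * (\<Sum>j=1..i. a i j * L j x)
                                + \<tau> * (\<Sum>j=1..<i. a' i j * N j x)"
      "\<forall>i\<in>{1..s}. R i = r + \<tau> * (\<Sum>j=1..<i. a' i j * N' j)"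
    and relaxation:
      "D = \<epsilon>\<^sup>2 / 2 * (L2_norm \<Omega> (gradient (\<lambda>x. (\<Sum>i=1..s. b i * L i x) + (\<Sum>i=1..s. b' i * N i x))))\<^sup>2
           + (\<Sum>i=1..s. b' i * N' i)\<^sup>2"
      "\<gamma> = (if D \<noteq> 0
            then (\<Sum>i=1..s. \<epsilon>\<^sup>2 * L2_inner \<Omega> (\<lambda>x. u x - U i x)
                                       (laplacian (\<lambda>x. b i * L i x + b' i * N i x))
                             - 2 * (r - R i) * b' i * N' i) / (\<tau> * D)
            else 1)"
    and update:
      "\<forall>x. u_new x = u x + \<gamma> * \<tau> * (\<Sum>i=1..s. b i * L i x + b' i * N i x)"
      "r_new = r + \<gamma> * \<tau> * (\<Sum>i=1..s. b' i * N' i)"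
    and gamma_pos: "\<gamma> > 0"
    and weights: "\<forall>j\<in>{1..s}. b j = b' j \<and> b' j \<ge> 0"
  shows "sav_energy \<Omega> \<epsilon> C\<^sub>0 u_new r_new \<le> sav_energy \<Omega> \<epsilon> C\<^sub>0 u r"
proof -
  note [simp del] = C_k.simps One_nat_def
  \<comment> \<open>\<open>H i\<close> is the full right-hand side at stage \<open>i\<close>,
    \<open>S\<close> and \<open>M\<close> are the update directions for \<open>u\<close> and
    \<open>r\<close>, and \<open>J\<close> is the Dirichlet form.\<close>
  define H where "H i = (\<lambda>x. L i x + N i x)" for i
  define S where "S = (\<lambda>x. \<Sum>i=1..s. b i * H i x)"
  define J where "J v w = L2_inner \<Omega> (gradient v) (gradient w)" for v w :: "'a \<Rightarrow> real"
  define M where "M = (\<Sum>i=1..s. b i * N' i)"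
  have bb: "b' i = b i" "b i \<ge> 0" if "i \<in> {1..s}" for i
    using weights that by auto
  have U: "C_k 2 (U i)" "C_k 1 (U i)" "C_k 2 (laplacian (U i))" "C_k 2 (H i)" "C_k 1 (H i)"
    "periodic_box lo hi (U i)" if "i \<in> {1..s}" for i
    using regular(2) periodic(2) that by (auto simp: H_def intro!: C_k_add C_2_D)
  have stage: "periodic_box lo hi (H i)" "\<epsilon>\<^sup>2 * J (U i) (H i) + 2 * R i * N' i \<le> 0"
    if "i \<in> {1..s}" for i
    using sav_stage_dissipation[OF domain(1) operator potential(1) U(1,3,6)[OF that],
        of \<epsilon> C\<^sub>0 "R i"] U(5)[OF that] rhs that
    by (auto simp: H_def J_def domain(2))
  have S: "C_k 1 S" unfolding S_def by (intro C_k_sum C_k_cmult U)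
  have cu: "continuous_on UNIV (gradient u)" and cS: "continuous_on UNIV (gradient S)"
    using continuous_gradient[OF regular(1)] continuous_gradient[OF S] .
  have cS': "continuous_on UNIV (\<lambda>x. (\<gamma> * \<tau>) *\<^sub>R gradient S x)"
    using cS by (intro continuous_intros)
  have M: "(\<Sum>i=1..s. b' i * N' i) = M"
    unfolding M_def by (intro sum.cong) (auto simp: bb)
  \<comment> \<open>Equal weights merge the implicit and explicit sums, so that only the
    combinations \<open>H i\<close> occur.\<close>
  have S_eq: "(\<Sum>i=1..s. b i * L i x + b' i * N i x) = S x"
    "(\<Sum>i=1..s. b i * L i x) + (\<Sum>i=1..s. b' i * N i x) = S x" for x
    unfolding S_def H_def sum.distrib[symmetric]
    by (intro sum.cong; simp add: bb algebra_simps)+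
  \<comment> \<open>\<open>D\<close> is the quadratic part of the energy evaluated at the direction
    (\<open>S\<close>, \<open>M\<close>).\<close>
  have D_eq: "D = \<epsilon>\<^sup>2 / 2 * J S S + M\<^sup>2"
    unfolding relaxation(1) S_eq(2) M L2_norm_power2 J_def by simp
  have JuS: "J u S = (\<Sum>i=1..s. b i * J u (H i))"
    unfolding J_def S_def domain(2) by (rule L2_inner_gradient_sum_right[OF regular(1) U(5)])
  have gnew: "gradient u_new = (\<lambda>x. gradient u x + (\<gamma> * \<tau>) *\<^sub>R gradient S x)"
  proof -
    have "u_new = (\<lambda>x. u x + \<gamma> * \<tau> * S x)" using update(1) by (auto simp: S_eq)
    then show ?thesis
      by (simp add: gradient_add[OF regular(1) C_k_cmult[OF S]] gradient_cmult[OF S])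
  qed
  have cnew: "continuous_on UNIV (gradient u_new)"
    unfolding gnew by (intro continuous_intros cu cS)
  have Jnew: "L2_inner \<Omega> v (gradient u_new)
      = L2_inner \<Omega> v (gradient u) + \<gamma> * \<tau> * L2_inner \<Omega> v (gradient S)"
    if "continuous_on UNIV v" for v
    unfolding gnew domain(2) L2_inner_add_right[OF that cu cS'] L2_inner_cmult_right ..
  have Jnn: "J u_new u_new = J u u + 2 * (\<gamma> * \<tau>) * J u S + (\<gamma> * \<tau>)\<^sup>2 * J S S"
    unfolding J_def Jnew[OF cnew] L2_inner_commute[of _ "gradient u_new" "gradient u"]
      L2_inner_commute[of _ "gradient u_new" "gradient S"] Jnew[OF cu] Jnew[OF cS]
      L2_inner_commute[of _ "gradient S" "gradient u"]
    by (simp add: power2_eq_square algebra_simps)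
  have "sav_energy \<Omega> \<epsilon> C\<^sub>0 u_new r_new - sav_energy \<Omega> \<epsilon> C\<^sub>0 u r
      = \<epsilon>\<^sup>2 / 2 * (J u_new u_new - J u u) + (r + \<gamma> * \<tau> * M)\<^sup>2 - r\<^sup>2"
    unfolding sav_energy_def L2_norm_power2 J_def update(2) M by (simp add: algebra_simps)
  \<comment> \<open>In the bracket, the first two terms are the derivative of the energy at
    (\<open>u\<close>, \<open>r\<close>) in direction (\<open>S\<close>, \<open>M\<close>); the last
    is the second-order contribution.\<close>
  also have "\<dots> = \<gamma> * \<tau> * (\<epsilon>\<^sup>2 * J u S + 2 * r * M + \<gamma> * \<tau> * D)"
    unfolding Jnn D_eq by (simp add: power2_eq_square algebra_simps)
  also have "\<dots> \<le> 0"
  proof (cases "D = 0")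
    case True
    have "J S S \<ge> 0" by (simp add: J_def L2_inner_nonneg)
    \<comment> \<open>Two nonnegative terms with sum zero both vanish. Then the first-order terms
      vanish as well: \<open>M\<close> is zero, and \<open>J u S\<close> is zero by the degenerate
      Cauchy-Schwarz lemma.\<close>
    then have "\<epsilon>\<^sup>2 / 2 * J S S = 0 \<and> M\<^sup>2 = 0"
      using True params(1) by (subst add_nonneg_eq_0_iff[symmetric]) (auto simp: D_eq)
    then have "J S S = 0" "M = 0" using params(1) by auto
    moreover from this have "J u S = 0"
      using L2_inner_eq_0_right[OF cu cS] by (simp add: J_def domain(2))
    ultimately show ?thesis using True by simp
  next
    case False
    \<comment> \<open>Each summand of the numerator of \<gamma> is the weighted stage dissipation
      minus its share of the first-order energy change at (\<open>u\<close>,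
      \<open>r\<close>).\<close>
    have term_eq: "\<epsilon>\<^sup>2 * L2_inner \<Omega> (\<lambda>x. u x - U i x) (laplacian (\<lambda>x. b i * L i x + b' i * N i x))
        - 2 * (r - R i) * b' i * N' i
      = b i * (\<epsilon>\<^sup>2 * J (U i) (H i) + 2 * R i * N' i) - (\<epsilon>\<^sup>2 * (b i * J u (H i)) + 2 * r * (b i * N' i))"
      if i: "i \<in> {1..s}" for i
    proof -
      \<comment> \<open>Writing the difference as a sum with a scalar multiple lets the additive and
        scaling rules for \<open>C_k\<close> and \<open>gradient\<close> apply.\<close>
      let ?d = "\<lambda>x. u x + (- 1) * U i x"
      have U': "C_k 1 (\<lambda>x. (- 1) * U i x)" by (rule C_k_cmult[OF U(2)[OF i]])
      have d: "C_k 1 ?d" by (rule C_k_add[OF regular(1) U'])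
      have pd: "periodic_box lo hi ?d"
        using periodic(1) U(6)[OF i] by (simp add: periodic_box_def)
      have gd: "gradient ?d = (\<lambda>x. gradient u x + (- 1) *\<^sub>R gradient (U i) x)"
        unfolding gradient_add[OF regular(1) U'] gradient_cmult[OF U(2)[OF i]] ..
      have "(\<lambda>x. b i * L i x + b' i * N i x) = (\<lambda>x. b i * H i x)"
        by (simp add: H_def bb[OF i] algebra_simps)
      then have "laplacian (\<lambda>x. b i * L i x + b' i * N i x) = (\<lambda>x. b i *\<^sub>R laplacian (H i) x)"
        using laplacian_cmult[OF U(4)[OF i]] by simp
      then have "L2_inner \<Omega> (\<lambda>x. u x - U i x) (laplacian (\<lambda>x. b i * L i x + b' i * N i x))
          = b i * L2_inner \<Omega> ?d (laplacian (H i))"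
        by (simp add: L2_inner_cmult_right del: real_scaleR_def)
      also have "L2_inner \<Omega> ?d (laplacian (H i)) = - J (H i) ?d"
        unfolding domain(2) J_def
        using green_periodic[OF domain(1) d pd U(4)[OF i] stage(1)[OF i]]
        by (simp add: L2_inner_commute)
      also have "J (H i) ?d = J (H i) u + (- 1) * J (H i) (U i)"
        unfolding J_def gd domain(2) L2_inner_cmult_right[symmetric]
        by (intro L2_inner_add_right continuous_intros continuous_gradient U i regular(1))
      also have "\<dots> = J u (H i) - J (U i) (H i)"
        by (simp add: J_def L2_inner_commute)
      finally have inner_eq:
        "L2_inner \<Omega> (\<lambda>x. u x - U i x) (laplacian (\<lambda>x. b i * L i x + b' i * N i x))
          = b i * - (J u (H i) - J (U i) (H i))" .
      show ?thesis by (simp only: inner_eq) (simp add: bb[OF i] algebra_simps)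
    qed
    \<comment> \<open>The definition of \<gamma> with its denominator cleared.\<close>
    have "\<gamma> * \<tau> * D = (\<Sum>i=1..s. \<epsilon>\<^sup>2 * L2_inner \<Omega> (\<lambda>x. u x - U i x)
        (laplacian (\<lambda>x. b i * L i x + b' i * N i x)) - 2 * (r - R i) * b' i * N' i)"
      using relaxation(2) False params(3) by simp
    also have "\<dots> = (\<Sum>i=1..s. b i * (\<epsilon>\<^sup>2 * J (U i) (H i) + 2 * R i * N' i)
        - (\<epsilon>\<^sup>2 * (b i * J u (H i)) + 2 * r * (b i * N' i)))"
      by (intro sum.cong term_eq) auto
    also have "\<dots> = (\<Sum>i=1..s. b i * (\<epsilon>\<^sup>2 * J (U i) (H i) + 2 * R i * N' i))
        - (\<epsilon>\<^sup>2 * J u S + 2 * r * M)"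
      by (simp only: sum_subtractf sum.distrib JuS M_def sum_distrib_left)
    \<comment> \<open>The first-order change at the old values cancels, leaving only dissipation at
      the stages, where each term is nonpositive and each weight nonnegative.\<close>
    finally have "\<epsilon>\<^sup>2 * J u S + 2 * r * M + \<gamma> * \<tau> * D
        = (\<Sum>i=1..s. b i * (\<epsilon>\<^sup>2 * J (U i) (H i) + 2 * R i * N' i))" by simp
    also have "\<dots> \<le> 0"
      by (intro sum_nonpos mult_nonneg_nonpos bb stage)
    finally show ?thesis
      using gamma_pos params(3) by (intro mult_nonneg_nonpos) auto
  qed
  finally show ?thesis by simp
qed

end
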